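(* Let $k\ge1$ be an integer and let $P=(E,r)$ be a $k$-polymatroid. (i) If $k$ is odd, then $$T_k(P;x+1,y+1)=\sum_{A\subseteq E}T_k(P|_A;0,y+1)\,T_k(P/A;x+1,0).$$ (ii) If $k$ is even, then both $$T_k(P;x+1,y+1)=\sum_{A\subseteq E}(-1)^{r(P|_A)}\,\chi\big((P|_A)^*;-y\big)\,T_k(P/A;x+1,0)$$ and $$T_k(P;x+1,y+1)=\sum_{A\subseteq E}(-1)^{r(P/A)}\,T_k(P|_A;0,y+1)\,\chi(P/A;-x).$$
   Context: A polymatroid is a pair $P=(E,r)$ with $E$ a finite set and $r:2^E\to\mathbb{Z}$ such that $r(\emptyset)=0$, $r(A)\le r(B)$ whenever $A\subseteq B$, and $r(A)+r(B)\ge r(A\cup B)+r(A\cap B)$ for all $A,B\subseteq E$. It is a $k$-polymatroid if $r(\{e\})\le k$ for all $e\in E$. For a polymatroid $Q$, $r(Q)$ denotes the rank of its whole groundset. Restriction: $P|_A=(A,r|_{2^A})$. Contraction: $P/A=(E\setminus A,r_{P/A})$ with $r_{P/A}(X)=r(X\cup A)-r(A)$. The $k$-dual of a $k$-polymatroid $P=(E,r)$ is $P^*=(E,r^* )$ with $r^*(A)=k|A|+r(E\setminus A)-r(E)$. $k$-polymatroid Tutte polynomial: $T_k(P;x,y)=\sum_{A\subseteq E}(x-1)^{r(E)-r(A)}(y-1)^{k|A|-r(A)}$. Characteristic polynomial: $\chi(P;x)=\sum_{A\subseteq E}(-1)^{|A|}x^{r(E)-r(A)}$. *)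

theory Defs
  imports Main
begin

text \<open>
  A pair (E, r) of a groundset and a rank function. Only the values of r on subsets of E are
  meaningful: every definition below evaluates r on such subsets only.
\<close>

type_synonym 'e ranked_set = "'e set \<times> ('e set \<Rightarrow> int)"

abbreviation ground :: "'e ranked_set \<Rightarrow> 'e set" where
  "ground P \<equiv> fst P"

abbreviation rk :: "'e ranked_set \<Rightarrow> 'e set \<Rightarrow> int" where
  "rk P \<equiv> snd P"

definition polymatroid :: "'e ranked_set \<Rightarrow> bool" where
  "polymatroid P \<longleftrightarrow>
     finite (ground P) \<and>
     rk P {} = 0 \<and>
     (\<forall>A B. A \<subseteq> B \<and> B \<subseteq> ground P \<longrightarrow> rk P A \<le> rk P B) \<and>
     (\<forall>A B. A \<subseteq> ground P \<and> B \<subseteq> ground P \<longrightarrow>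
        rk P A + rk P B \<ge> rk P (A \<union> B) + rk P (A \<inter> B))"

definition k_polymatroid :: "nat \<Rightarrow> 'e ranked_set \<Rightarrow> bool" where
  "k_polymatroid k P \<longleftrightarrow> polymatroid P \<and> (\<forall>e \<in> ground P. rk P {e} \<le> int k)"

definition total_rank :: "'e ranked_set \<Rightarrow> int" where
  "total_rank P = rk P (ground P)"

definition restriction :: "'e ranked_set \<Rightarrow> 'e set \<Rightarrow> 'e ranked_set" where
  "restriction P A = (A, rk P)"

definition contraction :: "'e ranked_set \<Rightarrow> 'e set \<Rightarrow> 'e ranked_set" where
  "contraction P A = (ground P - A, \<lambda>X. rk P (X \<union> A) - rk P A)"

definition k_dual :: "nat \<Rightarrow> 'e ranked_set \<Rightarrow> 'e ranked_set" where
  "k_dual k P =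
     (ground P, \<lambda>A. int k * int (card A) + rk P (ground P - A) - rk P (ground P))"

text \<open>
  The two polynomials have integer coefficients and are given by their values in an arbitrary
  commutative ring; the polynomials themselves are the values at indeterminates.
  The exponents are non-negative for k-polymatroids (for the characteristic polynomial, for all
  polymatroids), so the conversion to nat loses nothing there.
\<close>

definition tutte :: "nat \<Rightarrow> 'e ranked_set \<Rightarrow> 'a::comm_ring_1 \<Rightarrow> 'a \<Rightarrow> 'a" where
  "tutte k P x y =
     (\<Sum>A \<in> Pow (ground P).
        (x - 1) ^ nat (rk P (ground P) - rk P A) *
        (y - 1) ^ nat (int k * int (card A) - rk P A))"

definition char_poly :: "'e ranked_set \<Rightarrow> 'a::comm_ring_1 \<Rightarrow> 'a" where
  "char_poly P x =
     (\<Sum>A \<in> Pow (ground P). (- 1) ^ card A * x ^ nat (rk P (ground P) - rk P A))"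

end

theory Submission
  imports Defs HOL.Binomial
begin

text \<open>
  Expanding the summands of the identity with \<open>\<chi>(P/A; -x)\<close> gives a sum over chains
  \<open>B \<subseteq> A \<subseteq> D \<subseteq> E\<close> in which \<open>A\<close> contributes only the sign \<open>(-1)\<^bsup>|A|\<^esup>\<close>: the signs \<open>(-1)\<^bsup>r(A)\<^esup>\<close>
  coming from the restriction and from the contraction cancel. Moebius inversion on the Boolean
  lattice then leaves the terms with \<open>B = A = D\<close>, which form the Tutte polynomial. This holds for
  every \<open>k\<close>. For odd \<open>k\<close> the signed characteristic polynomial is the Tutte polynomial at \<open>y = 0\<close>,
  which is (i); the remaining identity of (ii) is the same one applied to the \<open>k\<close>-dual.
\<close>

section \<open>Convolution on the Boolean lattice\<close>

lemma moebius_inversion_Pow: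
  fixes f :: "'e set \<Rightarrow> 'a::comm_ring_1"
  assumes "finite D"
  shows "(\<Sum>A\<in>Pow D. (- 1) ^ card A * (\<Sum>B\<in>Pow A. f B)) = (- 1) ^ card D * f D"
  using inclusion_exclusion_symmetric[of "\<lambda>A. \<Sum>B\<in>Pow A. f B" "\<lambda>A. (- 1) ^ card A * f A" D] assms
  by simp

lemma alternating_convolution_Pow:
  fixes f g :: "'e set \<Rightarrow> 'a::comm_ring_1"
  assumes "finite E"
  shows "(\<Sum>A\<in>Pow E. (- 1) ^ card A * (\<Sum>B\<in>Pow A. f B) * (\<Sum>D | D \<subseteq> E \<and> A \<subseteq> D. g D)) =
           (\<Sum>A\<in>Pow E. (- 1) ^ card A * f A * g A)"
proof -
  define F where "F A = (- 1) ^ card A * (\<Sum>B\<in>Pow A. f B)" for A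
  have "(\<Sum>A\<in>Pow E. F A * (\<Sum>D | D \<subseteq> E \<and> A \<subseteq> D. g D)) =
      (\<Sum>D\<in>Pow E. \<Sum>A | A \<subseteq> E \<and> A \<subseteq> D. F A * g D)"
    using sum.swap_restrict[of "Pow E" "Pow E" "\<lambda>A D. F A * g D" "(\<subseteq>)"] assms
    by (simp add: sum_distrib_left)
  also have "\<dots> = (\<Sum>D\<in>Pow E. (\<Sum>A\<in>Pow D. F A) * g D)"
    by (intro sum.cong) (auto simp: sum_distrib_right intro!: sum.cong)
  also have "\<dots> = (\<Sum>D\<in>Pow E. (- 1) ^ card D * f D * g D)"
    using assms by (auto simp: F_def moebius_inversion_Pow finite_subset intro!: sum.cong)
  finally show ?thesis
    by (simp add: F_def)
qed

lemma sum_Pow_Diff_Un: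
  assumes "A \<subseteq> E"
  shows "(\<Sum>C\<in>Pow (E - A). h (C \<union> A)) = (\<Sum>D | D \<subseteq> E \<and> A \<subseteq> D. h D)"
  by (rule sum.reindex_bij_witness[of _ "\<lambda>D. D - A" "\<lambda>C. C \<union> A"]) (use assms in auto)

lemma sum_Pow_compl: "(\<Sum>A\<in>Pow E. h (E - A)) = (\<Sum>A\<in>Pow E. h A)"
  by (rule sum.reindex_bij_witness[of _ "\<lambda>A. E - A" "\<lambda>A. E - A"]) auto

section \<open>Polymatroids and their minors\<close>

lemma polymatroid_finite: "polymatroid P \<Longrightarrow> finite (ground P)"
  by (simp add: polymatroid_def)

lemma polymatroid_rank_empty: "polymatroid P \<Longrightarrow> rk P {} = 0"
  by (simp add: polymatroid_def)

lemma polymatroid_rank_mono: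
  "polymatroid P \<Longrightarrow> A \<subseteq> B \<Longrightarrow> B \<subseteq> ground P \<Longrightarrow> rk P A \<le> rk P B"
  by (simp add: polymatroid_def)

lemma polymatroid_rank_submodular:
  "polymatroid P \<Longrightarrow> A \<subseteq> ground P \<Longrightarrow> B \<subseteq> ground P \<Longrightarrow>
     rk P (A \<union> B) + rk P (A \<inter> B) \<le> rk P A + rk P B"
  by (simp add: polymatroid_def)

lemma polymatroid_rank_nonneg:
  assumes "polymatroid P" and "A \<subseteq> ground P"
  shows "0 \<le> rk P A"
  using polymatroid_rank_mono[of P "{}" A] assms by (simp add: polymatroid_rank_empty)

lemma polymatroid_rank_Un_le:
  assumes "polymatroid P" and "A \<subseteq> ground P" and "B \<subseteq> ground P"
  shows "rk P (A \<union> B) \<le> rk P A + rk P B"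
proof -
  have "0 \<le> rk P (A \<inter> B)"
    using assms by (intro polymatroid_rank_nonneg) auto
  with polymatroid_rank_submodular[OF assms] show ?thesis
    by simp
qed

lemma k_polymatroid_polymatroid: "k_polymatroid k P \<Longrightarrow> polymatroid P"
  by (simp add: k_polymatroid_def)

lemma k_polymatroid_rank_le:
  assumes P: "k_polymatroid k P" and "A \<subseteq> ground P"
  shows "rk P A \<le> int k * int (card A)"
proof -
  have poly: "polymatroid P"
    using P by (rule k_polymatroid_polymatroid)
  then have "finite A"
    using assms(2) polymatroid_finite finite_subset by blast
  then show ?thesis
    using assms(2)
  proof (induction A)
    case empty
    then show ?case
      using poly by (simp add: polymatroid_rank_empty)
  next
    case (insert e A)
    then have "rk P (insert e A) \<le> rk P {e} + rk P A"
      using polymatroid_rank_Un_le[OF poly, of "{e}" A] by simp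
    also have "rk P {e} \<le> int k"
      using P insert.prems by (simp add: k_polymatroid_def)
    finally show ?case
      using insert by (simp add: algebra_simps)
  qed
qed

lemma k_polymatroid_rank_diff_le:
  assumes P: "k_polymatroid k P" and "A \<subseteq> B" and "B \<subseteq> ground P"
  shows "rk P B - rk P A \<le> int k * int (card (B - A))"
proof -
  have "rk P B = rk P (A \<union> (B - A))"
    using assms by (simp add: Un_absorb1)
  also have "\<dots> \<le> rk P A + rk P (B - A)"
    using assms by (intro polymatroid_rank_Un_le k_polymatroid_polymatroid) auto
  also have "rk P (B - A) \<le> int k * int (card (B - A))"
    using assms by (intro k_polymatroid_rank_le) auto
  finally show ?thesis
    by simp
qed

lemma ground_restriction [simp]: "ground (restriction P A) = A"
  and rk_restriction [simp]: "rk (restriction P A) X = rk P X"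
  by (simp_all add: restriction_def)

lemma ground_contraction [simp]: "ground (contraction P A) = ground P - A"
  and rk_contraction [simp]: "rk (contraction P A) X = rk P (X \<union> A) - rk P A"
  by (simp_all add: contraction_def)

lemma ground_k_dual [simp]: "ground (k_dual k P) = ground P"
  and rk_k_dual [simp]:
    "rk (k_dual k P) X = int k * int (card X) + rk P (ground P - X) - rk P (ground P)"
  by (simp_all add: k_dual_def)

lemma k_polymatroid_restriction:
  assumes "k_polymatroid k P" and "A \<subseteq> ground P"
  shows "k_polymatroid k (restriction P A)"
proof -
  have "polymatroid P"
    using assms(1) by (rule k_polymatroid_polymatroid)
  with assms(2) have "polymatroid (restriction P A)"
    unfolding polymatroid_def[of "restriction P A"]
    by (auto intro: finite_subset polymatroid_finite polymatroid_rank_empty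
        polymatroid_rank_mono polymatroid_rank_submodular)
  with assms show ?thesis
    by (auto simp: k_polymatroid_def)
qed

lemma polymatroid_contraction:
  assumes P: "polymatroid P" and A: "A \<subseteq> ground P"
  shows "polymatroid (contraction P A)"
  unfolding polymatroid_def
proof (intro conjI allI impI)
  show "finite (ground (contraction P A))"
    using P by (simp add: polymatroid_finite)
  show "rk (contraction P A) {} = 0"
    by simp
next
  fix X Y assume "X \<subseteq> Y \<and> Y \<subseteq> ground (contraction P A)"
  then show "rk (contraction P A) X \<le> rk (contraction P A) Y"
    using A by (auto intro!: polymatroid_rank_mono[OF P])
next
  fix X Y assume "X \<subseteq> ground (contraction P A) \<and> Y \<subseteq> ground (contraction P A)"
  then have "X \<union> A \<subseteq> ground P" "Y \<union> A \<subseteq> ground P"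
    using A by auto
  from polymatroid_rank_submodular[OF P this]
  have "rk P (X \<union> Y \<union> A) + rk P (X \<inter> Y \<union> A) \<le> rk P (X \<union> A) + rk P (Y \<union> A)"
    by (simp add: Un_ac Un_Int_distrib)
  then show "rk (contraction P A) (X \<union> Y) + rk (contraction P A) (X \<inter> Y)
      \<le> rk (contraction P A) X + rk (contraction P A) Y"
    by simp
qed

lemma k_polymatroid_contraction:
  assumes P: "k_polymatroid k P" and A: "A \<subseteq> ground P"
  shows "k_polymatroid k (contraction P A)"
  unfolding k_polymatroid_def
proof (intro conjI ballI)
  show "polymatroid (contraction P A)"
    using P A by (intro polymatroid_contraction k_polymatroid_polymatroid)
  fix e assume "e \<in> ground (contraction P A)"
  then have e: "e \<in> ground P"
    by simp
  have "rk P ({e} \<union> A) - rk P A \<le> rk P {e}"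
    using polymatroid_rank_Un_le[OF k_polymatroid_polymatroid[OF P], of "{e}" A] e A by simp
  also have "\<dots> \<le> int k"
    using P e by (simp add: k_polymatroid_def)
  finally show "rk (contraction P A) {e} \<le> int k"
    by simp
qed

section \<open>Duality\<close>

lemma int_card_Diff:
  assumes "finite A" and "B \<subseteq> A"
  shows "int (card (A - B)) = int (card A) - int (card B)"
  using assms by (simp add: card_Diff_subset card_mono finite_subset)

lemma polymatroid_k_dual:
  assumes P: "k_polymatroid k P"
  shows "polymatroid (k_dual k P)"
proof -
  define E where "E = ground P"
  have poly: "polymatroid P"
    using P by (rule k_polymatroid_polymatroid)
  then have fin: "finite E"
    by (simp add: E_def polymatroid_finite)
  show ?thesis
    unfolding polymatroid_def
  proof (intro conjI allI impI)
    show "finite (ground (k_dual k P))" "rk (k_dual k P) {} = 0"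
      using fin by (simp_all add: E_def)
  next
    fix A B assume "A \<subseteq> B \<and> B \<subseteq> ground (k_dual k P)"
    then have "A \<subseteq> B" "B \<subseteq> E" "finite B"
      using fin by (auto simp: E_def intro: finite_subset)
    then have "E - A - (E - B) = B - A"
      by auto
    then have "rk P (E - A) - rk P (E - B) \<le> int k * int (card (B - A))"
      using \<open>A \<subseteq> B\<close> k_polymatroid_rank_diff_le[OF P, of "E - B" "E - A"]
      by (auto simp: E_def)
    also have "int (card (B - A)) = int (card B) - int (card A)"
      using \<open>finite B\<close> \<open>A \<subseteq> B\<close> by (rule int_card_Diff)
    finally show "rk (k_dual k P) A \<le> rk (k_dual k P) B"
      by (simp add: E_def algebra_simps)
  next
    fix A B assume "A \<subseteq> ground (k_dual k P) \<and> B \<subseteq> ground (k_dual k P)"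
    then have "finite A" "finite B"
      using fin by (auto simp: E_def intro: finite_subset)
    then have "int k * int (card A) + int k * int (card B) =
        int k * int (card (A \<union> B)) + int k * int (card (A \<inter> B))"
      by (simp add: card_Un_Int[of A B] flip: of_nat_add distrib_left)
    then show "rk (k_dual k P) (A \<union> B) + rk (k_dual k P) (A \<inter> B)
        \<le> rk (k_dual k P) A + rk (k_dual k P) B"
      using polymatroid_rank_submodular[OF poly, of "E - A" "E - B"]
      by (simp add: E_def Diff_Un Diff_Int)
  qed
qed

lemma tutte_k_dual:
  assumes P: "polymatroid P"
  shows "tutte k (k_dual k P) x y = tutte k P y x"
proof -
  define E where "E = ground P"
  define r where "r = rk P"
  have fin: "finite E" and empty: "r {} = 0"
    using P by (simp_all add: E_def r_def polymatroid_finite polymatroid_rank_empty)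
  have "tutte k (k_dual k P) x y =
      (\<Sum>A\<in>Pow E. (x - 1) ^ nat (int k * int (card (E - A)) - r (E - A)) *
         (y - 1) ^ nat (r E - r (E - A)))"
    unfolding tutte_def using fin empty
    by (intro sum.cong) (simp_all add: E_def r_def int_card_Diff algebra_simps)
  also have "\<dots> =
      (\<Sum>A\<in>Pow E. (x - 1) ^ nat (int k * int (card A) - r A) * (y - 1) ^ nat (r E - r A))"
    by (rule sum_Pow_compl)
  finally show ?thesis
    by (simp add: tutte_def E_def r_def mult.commute)
qed

text \<open>
  Equality up to the irrelevant values of the rank functions outside the groundset: the
  identities for minors of the dual below fail for plain equality of pairs.
\<close>

definition rank_equiv :: "'e ranked_set \<Rightarrow> 'e ranked_set \<Rightarrow> bool" where
  "rank_equiv P Q \<longleftrightarrow> ground P = ground Q \<and> (\<forall>A \<subseteq> ground P. rk P A = rk Q A)"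

lemma total_rank_cong: "rank_equiv P Q \<Longrightarrow> total_rank P = total_rank Q"
  by (simp add: rank_equiv_def total_rank_def)

lemma tutte_cong: "rank_equiv P Q \<Longrightarrow> tutte k P x y = tutte k Q x y"
  by (auto simp: rank_equiv_def tutte_def intro!: sum.cong)

lemma char_poly_cong: "rank_equiv P Q \<Longrightarrow> char_poly P x = char_poly Q x"
  by (auto simp: rank_equiv_def char_poly_def intro!: sum.cong)

lemma restriction_k_dual:
  assumes "A \<subseteq> ground P"
  shows "rank_equiv (restriction (k_dual k P) (ground P - A)) (k_dual k (contraction P A))"
proof -
  have "ground P - A - X \<union> A = ground P - X" if "X \<subseteq> ground P - A" for X
    using assms that by auto
  with assms show ?thesis
    by (simp add: rank_equiv_def Un_absorb2)
qed

lemma contraction_k_dual: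
  assumes "finite (ground P)" and "A \<subseteq> ground P"
  shows "rank_equiv (contraction (k_dual k P) (ground P - A)) (k_dual k (restriction P A))"
proof -
  have "card (X \<union> (ground P - A)) = card X + card (ground P - A)"
    and "ground P - (X \<union> (ground P - A)) = A - X" if "X \<subseteq> A" for X
    using assms that by (auto intro: card_Un_disjoint finite_subset)
  with assms show ?thesis
    by (simp add: rank_equiv_def double_diff algebra_simps)
qed

section \<open>Convolution formulas\<close>

definition rank_sign :: "'e ranked_set \<Rightarrow> 'e set \<Rightarrow> 'a::comm_ring_1" where
  "rank_sign P A = (- 1) ^ nat (rk P A)"

lemma rank_sign_mult_self [simp]: "rank_sign P A * rank_sign P A = 1"
  by (simp add: rank_sign_def)

lemma rank_sign_left_mult_self [simp]: "rank_sign P A * (rank_sign P A * a) = a"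
  by (simp flip: mult.assoc)

lemma minus_one_power_rank_diff:
  assumes "polymatroid P" and "A \<subseteq> B" and "B \<subseteq> ground P"
  shows "(- 1) ^ nat (rk P B - rk P A) = rank_sign P A * rank_sign P B"
proof -
  have "0 \<le> rk P A" "rk P A \<le> rk P B"
    using assms by (auto intro: polymatroid_rank_nonneg polymatroid_rank_mono)
  then show ?thesis
    by (simp add: rank_sign_def minus_one_power_iff even_nat_iff)
qed

lemma tutte_restriction_at_0:
  assumes "polymatroid P" and "A \<subseteq> ground P"
  shows "tutte k (restriction P A) 0 (y + 1) =
    rank_sign P A * (\<Sum>B\<in>Pow A. rank_sign P B * y ^ nat (int k * int (card B) - rk P B))"
  using assms
  by (auto simp: tutte_def minus_one_power_rank_diff sum_distrib_left mult_ac intro!: sum.cong)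

lemma signed_char_poly_contraction:
  fixes x :: "'a::comm_ring_1"
  assumes P: "polymatroid P" and A: "A \<subseteq> ground P"
  shows "(- 1) ^ nat (total_rank (contraction P A)) * char_poly (contraction P A) (- x) =
    (- 1) ^ card A * rank_sign P A *
      (\<Sum>D | D \<subseteq> ground P \<and> A \<subseteq> D.
         (- 1) ^ card D * rank_sign P D * x ^ nat (rk P (ground P) - rk P D))"
proof -
  define E where "E = ground P"
  define h where "h D = (- 1) ^ card D * rank_sign P D * x ^ nat (rk P E - rk P D)" for D
  have "(- 1) ^ nat (rk P E - rk P A) *
      ((- 1) ^ card C * (- x) ^ nat (rk P E - rk P (C \<union> A))) =
      (- 1) ^ card A * rank_sign P A * h (C \<union> A)" if C: "C \<subseteq> E - A" for C
  proof -
    have "finite E"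
      using P by (simp add: E_def polymatroid_finite)
    then have "card (C \<union> A) = card C + card A"
      using C A by (intro card_Un_disjoint) (auto simp: E_def intro: finite_subset)
    then have "(- 1) ^ card C = ((- 1) ^ card A * (- 1) ^ card (C \<union> A) :: 'a)"
      by (simp add: minus_one_power_iff)
    moreover have "A \<subseteq> E" "C \<union> A \<subseteq> E"
      using C A by (auto simp: E_def)
    then have "(- 1) ^ nat (rk P E - rk P A) = rank_sign P A * (rank_sign P E :: 'a)"
      and "(- 1) ^ nat (rk P E - rk P (C \<union> A)) = rank_sign P (C \<union> A) * (rank_sign P E :: 'a)"
      using P by (simp_all add: E_def minus_one_power_rank_diff)
    ultimately show ?thesis
      by (simp add: h_def power_minus[of x] mult_ac)
  qed
  then have "(- 1) ^ nat (total_rank (contraction P A)) * char_poly (contraction P A) (- x) =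
      (\<Sum>C\<in>Pow (E - A). (- 1) ^ card A * rank_sign P A * h (C \<union> A))"
    using A
    by (auto simp: char_poly_def total_rank_def sum_distrib_left Un_absorb2
        simp flip: E_def intro!: sum.cong)
  also have "\<dots> = (- 1) ^ card A * rank_sign P A * (\<Sum>D | D \<subseteq> E \<and> A \<subseteq> D. h D)"
    using A by (simp add: sum_Pow_Diff_Un E_def flip: sum_distrib_left)
  finally show ?thesis
    by (simp add: h_def E_def)
qed

theorem tutte_convolution_contraction:
  assumes P: "polymatroid P"
  shows "tutte k P (x + 1) (y + 1) =
    (\<Sum>A\<in>Pow (ground P). tutte k (restriction P A) 0 (y + 1) *
       ((- 1) ^ nat (total_rank (contraction P A)) * char_poly (contraction P A) (- x)))"
proof -
  define E where "E = ground P"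
  define X where "X D = x ^ nat (rk P E - rk P D)" for D
  define Y where "Y B = y ^ nat (int k * int (card B) - rk P B)" for B
  define f where "f B = rank_sign P B * Y B" for B
  define g where "g D = (- 1) ^ card D * rank_sign P D * X D" for D
  have "tutte k P (x + 1) (y + 1) = (\<Sum>A\<in>Pow E. (- 1) ^ card A * f A * g A)"
    by (simp add: tutte_def E_def X_def Y_def f_def g_def mult_ac)
  also have "\<dots> = (\<Sum>A\<in>Pow E. (- 1) ^ card A * (\<Sum>B\<in>Pow A. f B) *
      (\<Sum>D | D \<subseteq> E \<and> A \<subseteq> D. g D))"
    using P by (simp add: alternating_convolution_Pow E_def polymatroid_finite)
  also have "\<dots> = (\<Sum>A\<in>Pow E. (rank_sign P A * (\<Sum>B\<in>Pow A. f B)) *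
      ((- 1) ^ card A * rank_sign P A * (\<Sum>D | D \<subseteq> E \<and> A \<subseteq> D. g D)))"
    by (simp add: mult_ac)
  finally show ?thesis
    using P
    by (simp add: tutte_restriction_at_0 signed_char_poly_contraction E_def f_def g_def X_def Y_def)
qed

theorem tutte_convolution_restriction:
  assumes P: "k_polymatroid k P"
  shows "tutte k P (x + 1) (y + 1) =
    (\<Sum>A\<in>Pow (ground P).
       (- 1) ^ nat (total_rank (k_dual k (restriction P A))) *
       char_poly (k_dual k (restriction P A)) (- y) * tutte k (contraction P A) (x + 1) 0)"
proof -
  define E where "E = ground P"
  define Q where "Q = k_dual k P"
  have poly: "polymatroid P"
    using P by (rule k_polymatroid_polymatroid)
  have restr: "tutte k (restriction Q (E - A)) 0 (x + 1) = tutte k (contraction P A) (x + 1) 0"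
    if "A \<subseteq> E" for A
    using tutte_cong[OF restriction_k_dual[of A P k], of k 0 "x + 1"] that poly
    by (simp add: E_def Q_def tutte_k_dual polymatroid_contraction)
  have contr: "total_rank (contraction Q (E - A)) = total_rank (k_dual k (restriction P A))"
    "char_poly (contraction Q (E - A)) (- y) = char_poly (k_dual k (restriction P A)) (- y)"
    if "A \<subseteq> E" for A
    using contraction_k_dual[of P A k] that poly
    by (simp_all add: E_def Q_def polymatroid_finite total_rank_cong char_poly_cong)
  have "tutte k P (x + 1) (y + 1) = tutte k Q (y + 1) (x + 1)"
    unfolding Q_def using poly by (simp add: tutte_k_dual)
  also have "\<dots> = (\<Sum>A\<in>Pow E. tutte k (restriction Q A) 0 (x + 1) *
      ((- 1) ^ nat (total_rank (contraction Q A)) * char_poly (contraction Q A) (- y)))"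
    using tutte_convolution_contraction[OF polymatroid_k_dual[OF P]] by (simp add: E_def Q_def)
  also have "\<dots> = (\<Sum>A\<in>Pow E. tutte k (restriction Q (E - A)) 0 (x + 1) *
      ((- 1) ^ nat (total_rank (contraction Q (E - A))) *
       char_poly (contraction Q (E - A)) (- y)))"
    by (rule sum_Pow_compl[symmetric])
  finally show ?thesis
    by (simp add: restr contr mult_ac flip: E_def)
qed

lemma tutte_at_0_eq_signed_char_poly:
  assumes "odd k" and P: "k_polymatroid k P"
  shows "tutte k P (x + 1) 0 = (- 1) ^ nat (total_rank P) * char_poly P (- x)"
proof -
  define E where "E = ground P"
  have "x ^ nat (rk P E - rk P A) * (- 1) ^ nat (int k * int (card A) - rk P A) =
      (- 1) ^ nat (rk P E) * ((- 1) ^ card A * (- x) ^ nat (rk P E - rk P A))"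
    if "A \<subseteq> E" for A
  proof -
    have "0 \<le> rk P A" "rk P A \<le> rk P E"
      using k_polymatroid_polymatroid[OF P] that
      by (auto simp: E_def intro: polymatroid_rank_nonneg polymatroid_rank_mono)
    moreover have "rk P A \<le> int k * int (card A)"
      using P that by (simp add: E_def k_polymatroid_rank_le)
    ultimately show ?thesis
      using \<open>odd k\<close> unfolding power_minus[of x]
      by (auto simp: minus_one_power_iff even_nat_iff)
  qed
  then show ?thesis
    by (auto simp: tutte_def char_poly_def total_rank_def sum_distrib_left
        simp flip: E_def intro!: sum.cong)
qed

lemma minus_one_power_total_rank_k_dual:
  assumes "even k" and P: "k_polymatroid k P"
  shows "(- 1) ^ nat (total_rank (k_dual k P)) = ((- 1) ^ nat (total_rank P) :: 'a::comm_ring_1)"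
proof -
  have poly: "polymatroid P"
    using P by (rule k_polymatroid_polymatroid)
  have "0 \<le> total_rank P"
    using poly by (simp add: total_rank_def polymatroid_rank_nonneg)
  moreover have "total_rank P \<le> int k * int (card (ground P))"
    using P by (simp add: total_rank_def k_polymatroid_rank_le)
  moreover have "total_rank (k_dual k P) = int k * int (card (ground P)) - total_rank P"
    using poly by (simp add: total_rank_def polymatroid_rank_empty)
  ultimately show ?thesis
    using \<open>even k\<close> by (simp add: minus_one_power_iff even_nat_iff)
qed

theorem theorem3p13:
  fixes k :: nat and P :: "'e ranked_set" and x y :: "'a::comm_ring_1"
  assumes "k \<ge> 1" and "k_polymatroid k P"
  shows "(odd k \<longrightarrow>
            tutte k P (x + 1) (y + 1) =
              (\<Sum>A \<in> Pow (ground P).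
                 tutte k (restriction P A) 0 (y + 1) * tutte k (contraction P A) (x + 1) 0)) \<and>
         (even k \<longrightarrow>
            tutte k P (x + 1) (y + 1) =
              (\<Sum>A \<in> Pow (ground P).
                 (- 1) ^ nat (total_rank (restriction P A)) *
                 char_poly (k_dual k (restriction P A)) (- y) *
                 tutte k (contraction P A) (x + 1) 0) \<and>
            tutte k P (x + 1) (y + 1) =
              (\<Sum>A \<in> Pow (ground P).
                 (- 1) ^ nat (total_rank (contraction P A)) *
                 tutte k (restriction P A) 0 (y + 1) *
                 char_poly (contraction P A) (- x)))"
proof (intro conjI impI)
  note P = \<open>k_polymatroid k P\<close>
  note convolution = tutte_convolution_contraction[OF k_polymatroid_polymatroid[OF P]]
  show "tutte k P (x + 1) (y + 1) = (\<Sum>A \<in> Pow (ground P).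
      tutte k (restriction P A) 0 (y + 1) * tutte k (contraction P A) (x + 1) 0)" if "odd k"
    using that P by (simp add: convolution tutte_at_0_eq_signed_char_poly k_polymatroid_contraction)
  show "tutte k P (x + 1) (y + 1) = (\<Sum>A \<in> Pow (ground P).
      (- 1) ^ nat (total_rank (restriction P A)) *
      char_poly (k_dual k (restriction P A)) (- y) *
      tutte k (contraction P A) (x + 1) 0)" if "even k"
    using that P by (simp add: tutte_convolution_restriction[OF P]
        minus_one_power_total_rank_k_dual k_polymatroid_restriction)
  show "tutte k P (x + 1) (y + 1) = (\<Sum>A \<in> Pow (ground P).
      (- 1) ^ nat (total_rank (contraction P A)) *
      tutte k (restriction P A) 0 (y + 1) *
      char_poly (contraction P A) (- x))"
    by (simp add: convolution mult_ac)
qed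

end
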